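(* Let $\mathcal{F}$ be a family of numerical semigroups, and let $\mathscr{A}(\mathcal{F})$ be the intersection of all arithmetic varieties containing $\mathcal{F}$. Then $\mathscr{A}(\mathcal{F})$ is a finite arithmetic variety if and only if $\mathcal{F}$ has finite cardinality.
   Context: $\mathbb{N}$ denotes the set of non-negative integers. A numerical semigroup is a subset $S\subseteq\mathbb{N}$ containing $0$, closed under addition, with $\mathbb{N}\setminus S$ finite. For numerical semigroups $S,T$, $T$ is an arithmetic extension of $S$ if there exist positive integers $d_1,\dots,d_n$ ($n\ge 1$) such that $T=\{x\in\mathbb{N}\mid \{d_1x,\dots,d_nx\}\subset S\}$. An arithmetic variety is a non-empty family $\mathscr{A}$ of numerical semigroups such that (a) if $S,T\in\mathscr{A}$ then $S\cap T\in\mathscr{A}$; (b) if $S\in\mathscr{A}$ and $T$ is an arithmetic extension of $S$, then $T\in\mathscr{A}$. It is called a finite arithmetic variety when $\mathscr{A}$ has finite cardinality. *)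

theory Defs
  imports Main
begin

definition numerical_semigroup :: "nat set \<Rightarrow> bool" where
  "numerical_semigroup S \<longleftrightarrow>
     0 \<in> S \<and> (\<forall>x\<in>S. \<forall>y\<in>S. x + y \<in> S) \<and> finite (UNIV - S)"

definition arithmetic_extension :: "nat set \<Rightarrow> nat set \<Rightarrow> bool" where
  "arithmetic_extension S T \<longleftrightarrow>
     numerical_semigroup S \<and> numerical_semigroup T \<and>
     (\<exists>n (d :: nat \<Rightarrow> nat). n \<ge> 1 \<and> (\<forall>i\<in>{1..n}. d i > 0) \<and>
        T = {x. {d i * x | i. i \<in> {1..n}} \<subseteq> S})"

definition arithmetic_variety :: "nat set set \<Rightarrow> bool" where
  "arithmetic_variety \<A> \<longleftrightarrow>
     \<A> \<noteq> {} \<and> (\<forall>S\<in>\<A>. numerical_semigroup S) \<and>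
     (\<forall>S\<in>\<A>. \<forall>T\<in>\<A>. S \<inter> T \<in> \<A>) \<and>
     (\<forall>S\<in>\<A>. \<forall>T. arithmetic_extension S T \<longrightarrow> T \<in> \<A>)"

definition finite_arithmetic_variety :: "nat set set \<Rightarrow> bool" where
  "finite_arithmetic_variety \<A> \<longleftrightarrow> arithmetic_variety \<A> \<and> finite \<A>"

text \<open>If every member of \<open>\<F>\<close> is a numerical semigroup, the intersection below is over a
  non-empty collection: the family of all numerical semigroups is an arithmetic variety.\<close>

definition generated_variety :: "nat set set \<Rightarrow> nat set set" where
  "generated_variety \<F> = \<Inter>{\<A>. arithmetic_variety \<A> \<and> \<F> \<subseteq> \<A>}"

end

theory Submission imports Defs begin

text \<open>
  An arithmetic extension of \<open>S\<close> always contains \<open>S\<close>, since \<open>S\<close> is closed under taking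
  multiples. Hence, for each bound \<open>C\<close>, the numerical semigroups containing all integers from \<open>C\<close>
  on are stable under extensions, and they are clearly stable under intersection: they form an
  arithmetic variety (\<open>arithmetic_variety_semigroups_above\<close>). It is finite, because its members
  differ only below \<open>C\<close>. A finite family of numerical semigroups has a common bound \<open>C\<close>, so
  the variety it generates lies inside a finite one. Conversely, a family is contained in the
  variety that it generates.

  The intersection of varieties is again a variety, where only non-emptiness needs an argument:
  every variety contains \<open>\<nat>\<close>, which is an arithmetic extension of each numerical semigroup
  (\<open>arithmetic_extension_UNIV\<close>). This also covers the empty family, which generates \<open>{\<nat>}\<close>.
\<close>

lemma numerical_semigroup_UNIV: "numerical_semigroup UNIV"
  by (simp add: numerical_semigroup_def)

lemma numerical_semigroup_Int:
  assumes "numerical_semigroup S" "numerical_semigroup T"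
  shows "numerical_semigroup (S \<inter> T)"
  using assms by (simp add: numerical_semigroup_def Diff_Int)

lemma numerical_semigroup_mult:
  assumes "numerical_semigroup S" "x \<in> S"
  shows "d * x \<in> S"
  using assms by (induction d) (auto simp: numerical_semigroup_def)

lemma numerical_semigroup_bound:
  assumes "numerical_semigroup S"
  obtains C where "{C..} \<subseteq> S"
proof -
  have "finite (UNIV - S)"
    using assms by (simp add: numerical_semigroup_def)
  then obtain C where "\<forall>n\<in>UNIV - S. n < C"
    using finite_nat_set_iff_bounded by blast
  then have "{C..} \<subseteq> S" by (auto simp flip: not_less)
  then show thesis by (rule that)
qed

lemma numerical_semigroups_common_bound:
  assumes "finite \<F>" and "\<And>S. S \<in> \<F> \<Longrightarrow> numerical_semigroup S"
  obtains C where "\<And>S. S \<in> \<F> \<Longrightarrow> {C..} \<subseteq> S"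
proof -
  have "\<forall>S\<in>\<F>. \<exists>C. {C..} \<subseteq> S"
    using assms(2) by (meson numerical_semigroup_bound)
  then obtain c where c: "\<And>S. S \<in> \<F> \<Longrightarrow> {c S..} \<subseteq> S"
    by metis
  have "{Max (c ` \<F>)..} \<subseteq> S" if "S \<in> \<F>" for S
  proof -
    have "c S \<le> Max (c ` \<F>)" using assms(1) that by simp
    then show ?thesis using c[OF that] by (auto intro: order_trans)
  qed
  then show thesis by (rule that)
qed

lemma arithmetic_extension_superset:
  assumes "arithmetic_extension S T"
  shows "S \<subseteq> T"
  using assms by (auto simp: arithmetic_extension_def numerical_semigroup_mult)

text \<open>A single multiplier beyond the last gap of \<open>S\<close> sends every positive integer into \<open>S\<close>.\<close>

lemma arithmetic_extension_UNIV:
  assumes "numerical_semigroup S"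
  shows "arithmetic_extension S UNIV"
proof -
  obtain C where C: "{C..} \<subseteq> S"
    using numerical_semigroup_bound[OF assms] .
  have "Suc C * x \<in> S" for x
  proof (cases x)
    case 0
    then show ?thesis using assms by (simp add: numerical_semigroup_def)
  next
    case (Suc y)
    then have "C \<le> Suc C * x" by simp
    then show ?thesis using C by auto
  qed
  then have "UNIV = {x. {Suc C * x | i. i \<in> {1..1::nat}} \<subseteq> S}"
    by auto
  then show ?thesis
    unfolding arithmetic_extension_def
    using assms numerical_semigroup_UNIV
    by (intro conjI exI[of _ "1::nat"] exI[of _ "\<lambda>_. Suc C"]) auto
qed

lemma UNIV_in_arithmetic_variety:
  assumes "arithmetic_variety \<A>"
  shows "UNIV \<in> \<A>"
  using assms arithmetic_extension_UNIV unfolding arithmetic_variety_def by blast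

definition semigroups_above :: "nat \<Rightarrow> nat set set" where
  "semigroups_above C = {S. numerical_semigroup S \<and> {C..} \<subseteq> S}"

lemma arithmetic_variety_semigroups_above: "arithmetic_variety (semigroups_above C)"
proof -
  have "T \<in> semigroups_above C"
    if "S \<in> semigroups_above C" "arithmetic_extension S T" for S T
    using that arithmetic_extension_superset[OF that(2)]
    by (auto simp: semigroups_above_def arithmetic_extension_def)
  moreover have "UNIV \<in> semigroups_above C"
    by (simp add: semigroups_above_def numerical_semigroup_UNIV)
  moreover have "S \<inter> T \<in> semigroups_above C"
    if "S \<in> semigroups_above C" "T \<in> semigroups_above C" for S T
    using that by (simp add: semigroups_above_def numerical_semigroup_Int)
  moreover have "\<forall>S\<in>semigroups_above C. numerical_semigroup S"
    by (simp add: semigroups_above_def)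
  ultimately show ?thesis
    unfolding arithmetic_variety_def by blast
qed

lemma finite_semigroups_above: "finite (semigroups_above C)"
proof (rule finite_subset)
  show "semigroups_above C \<subseteq> (\<lambda>A. A \<union> {C..}) ` Pow {..<C}"
  proof
    fix S assume "S \<in> semigroups_above C"
    then have "S = (S \<inter> {..<C}) \<union> {C..}"
      by (auto simp: semigroups_above_def)
    then show "S \<in> (\<lambda>A. A \<union> {C..}) ` Pow {..<C}" by blast
  qed
qed simp

text \<open>Some variety containing \<open>\<F>\<close> has to be given: an intersection over no varieties would be
  the family of all subsets of \<open>\<nat>\<close>.\<close>

lemma arithmetic_variety_generated_variety:
  assumes "arithmetic_variety \<A>" "\<F> \<subseteq> \<A>"
  shows "arithmetic_variety (generated_variety \<F>)"
proof -
  have "UNIV \<in> generated_variety \<F>"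
    by (simp add: generated_variety_def UNIV_in_arithmetic_variety)
  moreover have "generated_variety \<F> \<subseteq> \<A>"
    using assms by (auto simp: generated_variety_def)
  then have "\<forall>S\<in>generated_variety \<F>. numerical_semigroup S"
    using assms(1) unfolding arithmetic_variety_def by blast
  moreover have "\<forall>S\<in>generated_variety \<F>. \<forall>T\<in>generated_variety \<F>. S \<inter> T \<in> generated_variety \<F>"
    by (simp add: generated_variety_def arithmetic_variety_def)
  moreover have "\<forall>S\<in>generated_variety \<F>. \<forall>T. arithmetic_extension S T \<longrightarrow> T \<in> generated_variety \<F>"
    unfolding generated_variety_def arithmetic_variety_def by blast
  ultimately show ?thesis
    unfolding arithmetic_variety_def by blast
qed

theorem corollary11:
  fixes \<F> :: "nat set set"
  assumes "\<And>S. S \<in> \<F> \<Longrightarrow> numerical_semigroup S"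
  shows "finite_arithmetic_variety (generated_variety \<F>) \<longleftrightarrow> finite \<F>"
proof
  assume "finite_arithmetic_variety (generated_variety \<F>)"
  then have "finite (generated_variety \<F>)"
    by (simp add: finite_arithmetic_variety_def)
  moreover have "\<F> \<subseteq> generated_variety \<F>"
    by (auto simp: generated_variety_def)
  ultimately show "finite \<F>" by (rule rev_finite_subset)
next
  assume "finite \<F>"
  then obtain C where C: "\<And>S. S \<in> \<F> \<Longrightarrow> {C..} \<subseteq> S"
    using numerical_semigroups_common_bound[OF _ assms] by blast
  then have sub: "\<F> \<subseteq> semigroups_above C"
    using assms by (auto simp: semigroups_above_def)
  then have "generated_variety \<F> \<subseteq> semigroups_above C"
    using arithmetic_variety_semigroups_above by (auto simp: generated_variety_def)
  then have "finite (generated_variety \<F>)"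
    using finite_semigroups_above by (rule finite_subset)
  then show "finite_arithmetic_variety (generated_variety \<F>)"
    using arithmetic_variety_generated_variety[OF arithmetic_variety_semigroups_above sub]
    by (simp add: finite_arithmetic_variety_def)
qed

end
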